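(* Assume $c\le\underline c$ and $\Phi'(p_* )\ge0$. Let $\mathcal P=[\underline p_0,\bar p_0]$ and $\mathcal Q=[\underline q_0,\bar q_0]$ be sets of priors (closed intervals in $(0,1)$) such that $\mathcal P\subseteq\mathcal Q$. There exists a time $\hat t$ such that $F_{\mathcal Q}(t)\ge F_{\mathcal P}(t)$ for all $t<\hat t$ and $F_{\mathcal Q}(t)\le F_{\mathcal P}(t)$ for all $t>\hat t$.
   Context: **Primitives.** A decision maker (DM) takes an action $a\in\{\ell,r\}$ with payoff $u_a^\omega\in\mathbb R$ in unknown state of the world $\omega\in\{L,R\}$, where $u_r^R>u_\ell^R$, $u_\ell^L>u_r^L$, $u_r^R>u_r^L$, $u_\ell^R<u_\ell^L$. Before acting she may experiment at flow cost $c>0$; in state $R$ only, conclusive news ("breakthrough") arrives at rate $\lambda>0$, after which she stops immediately and takes $r$. $U_a(p)=pu_a^R+(1-p)u_a^L$; $\delta_a=|u_a^R-u_a^L|$. $\overline c=\lambda\frac{(u_r^R-u_\ell^R)(u_\ell^L-u_r^L)}{(u_r^R-u_\ell^R)+(u_\ell^L-u_r^L)}$, $\underline c=\frac{\delta_r}{\delta_r+\delta_\ell}\overline c$. **Bayesian benchmark.** For $0<p'\le p<1$, $\phi(p;p',v)=\frac{p-p'}{1-p'}u_r^R+\frac{1-p}{1-p'}v-\big[\frac{p-p'}{1-p'}+(1-p)\ln(\frac{p}{1-p}\frac{1-p'}{p'})\big]\frac c\lambda$; $\Phi(p)=\max_{p'\le p}\phi(p;p',U_\ell(p'))$; $\Phi^*=\max\{\Phi,U_r\}$;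 $p_*=\arg\min_{[0,1]}\Phi^*$; $p_\ell^B=\frac c{\lambda(u_r^R-u_\ell^R)}$. **Belief sets.** For a prior set $[\underline p_0,\bar p_0]$ put $\Delta=\ln\frac{\bar p_0}{1-\bar p_0}-\ln\frac{\underline p_0}{1-\underline p_0}$. The state variable is the highest belief $\bar p\in(0,1)$, starting at $\bar p_0$; the set of posteriors is $\{p\le\bar p:\ln\frac{\bar p}{1-\bar p}-\ln\frac p{1-p}\le\Delta\}$ with minimum $\underline p(\bar p)$. Absent news all beliefs drift by $\dot p=-\lambda p(1-p)$. **Equilibrium strategy** (of the ambiguity-averse, maxmin, sophisticated DM, for $c\le\underline c$ and in the case $\Phi'(p_* )=0$). At each state $\bar p$: $m(\bar p)$ is an instantaneous stopping probability, $\nu(\bar p)$ a stopping rate, $\rho(\bar p)$ the probability of $r$ upon stopping. Let $\hat V$ on $[p_*,1)$ solve $\bar p(1-\bar p)\hat V'(\bar p)=\frac{(u_r^R-\hat V(\bar p))(u_\ell^L-\hat V(\bar p))}{u_\ell^L-u_\ell^R}-\frac c\lambda$, $\hat V(p_* )=\Phi(p_* )$. Set $\bar p_1=p_\ell^B$, $\bar p_2=p_*$; $\bar p_3=p_*$ if $\Phi(p_* )\ge U_\ell(\underline p(p_* ))$, otherwise $\bar p_3$ is the solution of $\hat V(\bar p_3)=U_\ell(\underline p(\bar p_3))$; $\bar p_4>\bar p_3$ solves $\phi(\underline p(\bar p_4);\underline p(\bar p_3),\hat V(\bar p_3))=U_r(\underline p(\bar p_4))$. The equilibrium strategy for degree of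 ambiguity $\Delta$, denoted $\sigma_\Delta=(m,\nu,\rho)$, is: $(1,0,0)$ on $(0,\bar p_1]$; $(0,0,\cdot)$ on $(\bar p_1,\bar p_2]$; $(0,\nu^*(\bar p),0)$ with $\nu^*(\bar p)=\frac{\lambda(u_r^R-\hat V(\bar p))}{u_\ell^L-u_\ell^R}$ on $(\bar p_2,\bar p_3)$; $(0,0,\cdot)$ on $[\bar p_3,\bar p_4)$; $(1,0,1)$ on $[\bar p_4,1)$. **Stopping-time distribution.** For a prior set $\mathcal P$, $F_{\mathcal P}:[0,\infty)\to[0,1]$ is the cumulative distribution function of the time at which the DM stops when her initial set of priors is $\mathcal P$ and she follows the equilibrium strategy $\sigma_\Delta$, with $\Delta$ the degree of ambiguity of $\mathcal P$, conditional on no breakthrough (equivalently, conditional on $\omega=L$). *)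

theory Defs
  imports "HOL-Analysis.Analysis"
begin

datatype action = Act_l | Act_r

datatype world = World_L | World_R

definition log_odds :: "real \<Rightarrow> real" where
  "log_odds p = ln (p / (1 - p))"

(* Bayes' rule for the probability of World_R after time t without a breakthrough, which has
   likelihood exp (- lam * t) in World_R and 1 in World_L; belief_path_0 and
   belief_path_has_derivative show that this is the solution of p' = - lam * p * (1 - p)
   started at p0. *)
definition belief_path :: "real \<Rightarrow> real \<Rightarrow> real \<Rightarrow> real" where
  "belief_path lam p0 t = p0 * exp (- lam * t) / (p0 * exp (- lam * t) + (1 - p0))"

lemma belief_path_0: "belief_path lam p0 0 = p0"
  by (simp add: belief_path_def)

lemma belief_path_has_derivative:
  assumes "0 < p0" "p0 < 1"
  shows "(belief_path lam p0 has_real_derivative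
           - lam * belief_path lam p0 t * (1 - belief_path lam p0 t)) (at t)"
proof -
  have pos: "p0 * exp (- lam * t) + (1 - p0) > 0"
    using assms by (intro add_pos_pos mult_pos_pos) auto
  show ?thesis
    unfolding belief_path_def
    using pos
    by (auto intro!: derivative_eq_intros simp: divide_simps) (simp add: algebra_simps power2_eq_square)
qed

definition posterior_set :: "real \<Rightarrow> real \<Rightarrow> real set" where
  "posterior_set \<Delta> pbar =
     {p. 0 < p \<and> p \<le> pbar \<and> log_odds pbar - log_odds p \<le> \<Delta>}"

definition lowest_belief :: "real \<Rightarrow> real \<Rightarrow> real" where
  "lowest_belief \<Delta> pbar = Inf (posterior_set \<Delta> pbar)"

definition ambiguity :: "real \<Rightarrow> real \<Rightarrow> real" where
  "ambiguity plo phi = log_odds phi - log_odds plo"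

(* Law of the stopping time along a deterministic state path x when the decision maker stops
   with instantaneous probability m and at rate \<nu>. The (possibly uncountable) product of the
   factors 1 - m (x s) over s in {0..t} is the infimum of its finite subproducts, as all
   factors lie in {0..1}. *)
definition stop_cdf ::
    "(real \<Rightarrow> real) \<Rightarrow> (real \<Rightarrow> real) \<Rightarrow> (real \<Rightarrow> real) \<Rightarrow> real \<Rightarrow> real" where
  "stop_cdf m \<nu> x t =
     1 - (INF A\<in>{A. finite A \<and> A \<subseteq> {0..t}}. \<Prod>s\<in>A. 1 - m (x s))
         * exp (- integral {0..t} (\<lambda>s. \<nu> (x s)))"

locale wald_problem =
  fixes u :: "action \<Rightarrow> world \<Rightarrow> real"
    and c :: real
    and lam :: real
  assumes payoff_R: "u Act_r World_R > u Act_l World_R"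
    and payoff_L: "u Act_l World_L > u Act_r World_L"
    and payoff_r: "u Act_r World_R > u Act_r World_L"
    and payoff_l: "u Act_l World_R < u Act_l World_L"
    and cost_pos: "c > 0"
    and rate_pos: "lam > 0"
begin

definition U :: "action \<Rightarrow> real \<Rightarrow> real" where
  "U a p = p * u a World_R + (1 - p) * u a World_L"

definition \<delta> :: "action \<Rightarrow> real" where
  "\<delta> a = \<bar>u a World_R - u a World_L\<bar>"

definition c_upper :: real where
  "c_upper =
     lam * ((u Act_r World_R - u Act_l World_R) * (u Act_l World_L - u Act_r World_L)
            / ((u Act_r World_R - u Act_l World_R) + (u Act_l World_L - u Act_r World_L)))"

definition c_lower :: real where
  "c_lower = \<delta> Act_r / (\<delta> Act_r + \<delta> Act_l) * c_upper"

definition \<phi> :: "real \<Rightarrow> real \<Rightarrow> real \<Rightarrow> real" where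
  "\<phi> p p' v =
     (p - p') / (1 - p') * u Act_r World_R + (1 - p) / (1 - p') * v
     - ((p - p') / (1 - p') + (1 - p) * ln (p / (1 - p) * ((1 - p') / p'))) * (c / lam)"

(* On (0,1) the supremum is attained: \<phi> p p' (U Act_l p') tends to minus infinity as p' \<rightarrow> 0.
   At 0 and 1, where the formula for \<phi> breaks down, \<Phi> is extended by continuity. *)
definition \<Phi> :: "real \<Rightarrow> real" where
  "\<Phi> p =
     (if p = 0 then U Act_l 0
      else if p = 1 then max (U Act_l 1) (u Act_r World_R - c / lam)
      else (SUP p'\<in>{0<..p}. \<phi> p p' (U Act_l p')))"

definition \<Phi>_star :: "real \<Rightarrow> real" where
  "\<Phi>_star p = max (\<Phi> p) (U Act_r p)"

definition p_star :: real where
  "p_star = arg_min_on \<Phi>_star {0..1}"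

definition p_lB :: real where
  "p_lB = c / (lam * (u Act_r World_R - u Act_l World_R))"

definition solves_V_ode :: "(real \<Rightarrow> real) \<Rightarrow> bool" where
  "solves_V_ode V \<longleftrightarrow>
     V p_star = \<Phi> p_star \<and>
     (\<exists>V'. \<forall>p\<in>{p_star..<1}.
        (V has_real_derivative V' p) (at p within {p_star..<1}) \<and>
        p * (1 - p) * V' p =
          (u Act_r World_R - V p) * (u Act_l World_L - V p)
            / (u Act_l World_L - u Act_l World_R) - c / lam)"

(* Solutions agree on {p_star..<1}; V_hat is not used elsewhere. *)
definition V_hat :: "real \<Rightarrow> real" where
  "V_hat = (SOME V. solves_V_ode V)"

definition pbar1 :: real where
  "pbar1 = p_lB"

definition pbar2 :: real where
  "pbar2 = p_star"

definition pbar3 :: "real \<Rightarrow> real" where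
  "pbar3 \<Delta> =
     (if \<Phi> p_star \<ge> U Act_l (lowest_belief \<Delta> p_star) then p_star
      else (THE p. p_star \<le> p \<and> p < 1 \<and> V_hat p = U Act_l (lowest_belief \<Delta> p)))"

definition pbar4_eq :: "real \<Rightarrow> real \<Rightarrow> bool" where
  "pbar4_eq \<Delta> p \<longleftrightarrow>
     pbar3 \<Delta> < p \<and> p < 1 \<and>
     \<phi> (lowest_belief \<Delta> p) (lowest_belief \<Delta> (pbar3 \<Delta>)) (V_hat (pbar3 \<Delta>))
       = U Act_r (lowest_belief \<Delta> p)"

(* In the boundary case \<Delta> = 0 and \<Phi> p_star = U Act_r p_star the only solution of the equation
   is pbar3 \<Delta> itself, and the experimentation interval [pbar3 \<Delta>, pbar4 \<Delta>) is empty. *)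
definition pbar4 :: "real \<Rightarrow> real" where
  "pbar4 \<Delta> = (if \<exists>p. pbar4_eq \<Delta> p then THE p. pbar4_eq \<Delta> p else pbar3 \<Delta>)"

definition \<nu>_star :: "real \<Rightarrow> real" where
  "\<nu>_star p = lam * (u Act_r World_R - V_hat p) / (u Act_l World_L - u Act_l World_R)"

(* (m, \<nu>, \<rho>): stopping probability, stopping rate, probability of Act_r upon stopping;
   \<rho> is left undefined where the decision maker does not stop. *)
definition \<sigma> :: "real \<Rightarrow> real \<Rightarrow> real \<times> real \<times> real" where
  "\<sigma> \<Delta> p =
     (if p \<le> pbar1 then (1, 0, 0)
      else if p \<le> pbar2 then (0, 0, undefined)
      else if p < pbar3 \<Delta> then (0, \<nu>_star p, 0)
      else if p < pbar4 \<Delta> then (0, 0, undefined)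
      else (1, 0, 1))"

(* The prior set is {plo..phi}; the state variable starts at its maximum. *)
definition F :: "real \<Rightarrow> real \<Rightarrow> real \<Rightarrow> real" where
  "F plo phi =
     (let s = \<sigma> (ambiguity plo phi)
      in stop_cdf (\<lambda>p. fst (s p)) (\<lambda>p. fst (snd (s p))) (belief_path lam phi))"

end

end

(* In log odds y, an absence of news shifts all beliefs down at the constant speed lam, and V_hat
   solves the autonomous equation V' = V_rhs V. At the minimizer p_star of max \<Phi> U_r the derivative
   of \<Phi> is nonpositive, and together with \<Phi> >= U_l this puts \<Phi> p_star between the two zeros of
   V_rhs. Hence V_hat decreases, and both the stopping rate \<nu>_star and the belief q_hat p at which
   Act_l is worth V_hat p increase with p. The decision maker randomizes in state p > p_star exactly
   when her lowest belief is below q_hat p, that is, when G p = log_odds p - log_odds (q_hat p) is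
   below \<Delta>.
   Now compare nested prior sets along their paths. At every time the larger set has a higher highest
   and a lower lowest belief, so whenever the smaller set is in the randomization region, so is
   the larger one, at a higher rate. Thus the larger set stops earlier up to the time when the highest
   belief of the smaller set falls to pbar1, at which the smaller set stops for sure. If the smaller
   set stops at time 0, the crossing time is 0, whatever pbar4 is. *)
theory Submission
  imports Defs "HOL-Real_Asymp.Real_Asymp"
begin

section \<open>Stopping times and beliefs\<close>

lemma stop_cdf_le_1:
  assumes "\<And>s. 0 \<le> m s" "\<And>s. m s \<le> 1"
  shows "stop_cdf m \<nu> x t \<le> 1"
proof -
  have "0 \<le> (INF A\<in>{A. finite A \<and> A \<subseteq> {0..t}}. \<Prod>s\<in>A. 1 - m (x s))"
    by (rule cINF_greatest) (use assms in \<open>auto intro!: prod_nonneg\<close>)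
  then show ?thesis
    unfolding stop_cdf_def by simp
qed

text \<open>The infimum over finite subproducts is squeezed between 0 and the product over
  \<open>{s}\<close>, which vanishes, so the hazard integral no longer matters.\<close>

lemma stop_cdf_eq_1:
  assumes "\<And>s. 0 \<le> m s" "\<And>s. m s \<le> 1" and s: "0 \<le> s" "s \<le> t" "m (x s) = 1"
  shows "stop_cdf m \<nu> x t = 1"
proof -
  let ?A = "{A. finite A \<and> A \<subseteq> {0..t}}"
  let ?f = "\<lambda>A. \<Prod>s\<in>A. 1 - m (x s)"
  have nn: "0 \<le> ?f A" for A
    using assms by (auto intro!: prod_nonneg)
  have "0 \<le> (INF A\<in>?A. ?f A)"
    by (rule cINF_greatest) (use nn in auto)
  moreover have "(INF A\<in>?A. ?f A) \<le> ?f {s}"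
    by (rule cINF_lower) (use s nn in \<open>auto intro!: bdd_belowI[of _ 0]\<close>)
  ultimately have "(INF A\<in>?A. ?f A) = 0"
    using s by simp
  then show ?thesis
    unfolding stop_cdf_def by simp
qed

lemma stop_cdf_no_atom:
  assumes "\<And>s. 0 \<le> s \<Longrightarrow> s \<le> t \<Longrightarrow> m (x s) = 0"
  shows "stop_cdf m \<nu> x t = 1 - exp (- integral {0..t} (\<lambda>s. \<nu> (x s)))"
proof -
  have "(INF A\<in>{A. finite A \<and> A \<subseteq> {0..t}}. \<Prod>s\<in>A. 1 - m (x s))
      = (INF A\<in>{A. finite A \<and> A \<subseteq> {0..t}}. (1::real))"
    by (rule INF_cong) (use assms in \<open>auto intro!: prod.neutral\<close>)
  also have "\<dots> = 1"
    by (rule cINF_const) auto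
  finally show ?thesis
    unfolding stop_cdf_def by simp
qed

section \<open>Log odds as coordinates for beliefs\<close>

lemma log_odds_less_iff:
  assumes "0 < p" "p < 1" "0 < q" "q < 1"
  shows "log_odds p < log_odds q \<longleftrightarrow> p < q"
proof -
  have "log_odds p < log_odds q \<longleftrightarrow> p / (1 - p) < q / (1 - q)"
    unfolding log_odds_def using assms by (subst ln_less_cancel_iff) auto
  also have "\<dots> \<longleftrightarrow> p < q"
    using assms by (simp add: divide_simps) (simp add: algebra_simps)
  finally show ?thesis .
qed

lemma log_odds_le_iff:
  assumes "0 < p" "p < 1" "0 < q" "q < 1"
  shows "log_odds p \<le> log_odds q \<longleftrightarrow> p \<le> q"
  using log_odds_less_iff[of q p] assms by (auto simp: not_less[symmetric])

lemma log_odds_surj: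
  obtains p where "0 < p" "p < 1" "log_odds p = y"
proof
  let ?p = "exp y / (1 + exp y)"
  have e: "exp y > 0" by simp
  show "0 < ?p" "?p < 1"
    using e by (simp_all add: add_pos_pos)
  have "?p / (1 - ?p) = exp y"
    using e by (simp add: divide_simps add_pos_pos) (smt (verit) e)
  then show "log_odds ?p = y"
    unfolding log_odds_def by simp
qed

lemma log_odds_has_derivative:
  assumes "0 < p" "p < 1"
  shows "(log_odds has_real_derivative 1 / (p * (1 - p))) (at p within S)"
  unfolding log_odds_def using assms
  by (auto intro!: derivative_eq_intros simp: divide_simps)

lemma belief_path_bounds:
  assumes "0 < p" "p < 1"
  shows "0 < belief_path lam p t" "belief_path lam p t < 1"
proof -
  have "0 < p * exp (- lam * t)" using assms by simp
  then show "0 < belief_path lam p t" "belief_path lam p t < 1"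
    unfolding belief_path_def using assms by (simp_all add: add_pos_pos)
qed

lemma log_odds_belief_path:
  assumes "0 < p" "p < 1"
  shows "log_odds (belief_path lam p t) = log_odds p - lam * t"
proof -
  have e: "0 < p * exp (- (lam * t)) + (1 - p)" using assms by (simp add: add_pos_pos)
  have "belief_path lam p t / (1 - belief_path lam p t) = p / (1 - p) * exp (- lam * t)"
    unfolding belief_path_def using assms e by (simp add: divide_simps)
  then have "log_odds (belief_path lam p t) = ln (p / (1 - p) * exp (- lam * t))"
    unfolding log_odds_def by simp
  also have "\<dots> = log_odds p - lam * t"
    unfolding log_odds_def using assms by (subst ln_mult) auto
  finally show ?thesis .
qed

lemma belief_path_mono:
  assumes "0 < p" "p \<le> q" "q < 1"
  shows "belief_path lam p t \<le> belief_path lam q t"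
proof -
  have "log_odds (belief_path lam p t) \<le> log_odds (belief_path lam q t)"
    using assms log_odds_le_iff[of p q] by (simp add: log_odds_belief_path)
  then show ?thesis
    using assms by (subst (asm) log_odds_le_iff) (auto intro: belief_path_bounds)
qed

lemma belief_path_antimono:
  assumes "0 < p" "p < 1" "0 \<le> lam" "s \<le> t"
  shows "belief_path lam p t \<le> belief_path lam p s"
proof -
  have "log_odds (belief_path lam p t) \<le> log_odds (belief_path lam p s)"
    using assms by (simp add: log_odds_belief_path mult_left_mono)
  then show ?thesis
    using assms by (subst (asm) log_odds_le_iff) (auto intro: belief_path_bounds)
qed

lemma continuous_on_belief_path:
  assumes "0 < p" "p < 1"
  shows "continuous_on S (belief_path lam p)"
  using belief_path_has_derivative[OF assms]
  by (meson DERIV_isCont continuous_at_imp_continuous_on)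

text \<open>The posterior set is a closed interval whose left end has log odds
  \<open>log_odds p - \<Delta>\<close>, so its infimum is attained.\<close>

lemma lowest_belief_bounds:
  assumes "0 \<le> \<Delta>" "0 < p" "p < 1"
  shows "0 < lowest_belief \<Delta> p" "lowest_belief \<Delta> p < 1"
    and log_odds_lowest_belief: "log_odds (lowest_belief \<Delta> p) = log_odds p - \<Delta>"
proof -
  obtain q where q: "0 < q" "q < 1" "log_odds q = log_odds p - \<Delta>"
    by (rule log_odds_surj)
  have "q \<le> p"
    using q assms by (subst log_odds_le_iff[symmetric]) auto
  have "posterior_set \<Delta> p = {q..p}"
  proof (intro set_eqI iffI)
    fix r assume "r \<in> posterior_set \<Delta> p"
    then have r: "0 < r" "r \<le> p" "log_odds q \<le> log_odds r"
      using q by (auto simp: posterior_set_def)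
    then have "q \<le> r"
      using q assms by (subst log_odds_le_iff[symmetric]) auto
    then show "r \<in> {q..p}" using r by simp
  next
    fix r assume r: "r \<in> {q..p}"
    then have "log_odds q \<le> log_odds r"
      using q assms by (subst log_odds_le_iff) auto
    then show "r \<in> posterior_set \<Delta> p"
      using r q by (auto simp: posterior_set_def)
  qed
  then have "lowest_belief \<Delta> p = q"
    using \<open>q \<le> p\<close> by (simp add: lowest_belief_def)
  then show "0 < lowest_belief \<Delta> p" "lowest_belief \<Delta> p < 1"
    "log_odds (lowest_belief \<Delta> p) = log_odds p - \<Delta>"
    using q by auto
qed

text \<open>Integrating factor: \<open>f t * exp (- K t)\<close> has derivative 0. As the
  exponential is positive, \<open>f\<close> keeps its sign, which later keeps \<open>V_hat\<close>
  from crossing a constant solution of its equation.\<close>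

lemma linear_ode_eq:
  fixes f k :: "real \<Rightarrow> real"
  assumes "a \<le> b" and k: "continuous_on {a..b} k"
    and f: "\<And>t. t \<in> {a..b} \<Longrightarrow> (f has_real_derivative k t * f t) (at t within {a..b})"
  shows "f b = f a * exp (integral {a..b} k)"
proof -
  define K where "K = (\<lambda>t. integral {a..t} k)"
  have K: "(K has_real_derivative k t) (at t within {a..b})" if "t \<in> {a..b}" for t
    unfolding K_def using integral_has_real_derivative[OF k that] .
  have "\<exists>C. \<forall>t\<in>{a..b}. f t * exp (- K t) = C"
    by (rule has_field_derivative_zero_constant)
      (auto intro!: derivative_eq_intros f K simp: algebra_simps)
  then have "f b * exp (- K b) = f a * exp (- K a)"
    using assms(1) by force
  then show ?thesis
    by (simp add: K_def exp_minus field_simps)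
qed

section \<open>The Bayesian benchmark\<close>

context wald_problem
begin

section \<open>The cost bounds, the threshold \<open>p_lB\<close> and the payoff lines\<close>

abbreviation "rR \<equiv> u Act_r World_R"
abbreviation "rL \<equiv> u Act_r World_L"
abbreviation "lR \<equiv> u Act_l World_R"
abbreviation "lL \<equiv> u Act_l World_L"

text \<open>Value of experimenting until the belief falls to \<open>p_lB\<close> and then taking
  \<open>Act_l\<close>, kept as one formula; it is the Bayesian value from \<open>p_lB\<close>
  upwards. At 1 the logarithmic term vanishes because of its factor \<open>1 - p\<close>.\<close>

definition \<psi> :: "real \<Rightarrow> real" where
  "\<psi> p = \<phi> p p_lB (U Act_l p_lB)"

lemma c_lower_less_c_upper: "c_lower < c_upper"
proof -
  have "0 < c_upper"
    unfolding c_upper_def using payoff_R payoff_L rate_pos by (auto intro!: mult_pos_pos divide_pos_pos)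
  moreover have "\<delta> Act_r / (\<delta> Act_r + \<delta> Act_l) < 1"
    using payoff_r payoff_l by (auto simp: \<delta>_def divide_simps)
  ultimately show ?thesis
    unfolding c_lower_def using mult_strict_right_mono by fastforce
qed

lemma p_lB_times: "p_lB * (rR - lR) = c / lam"
  unfolding p_lB_def using payoff_R rate_pos by (simp add: field_simps)

lemma p_lB_pos: "0 < p_lB"
  unfolding p_lB_def using payoff_R cost_pos rate_pos by simp

text \<open>The bound is the belief at which both actions have the same value, so
  \<open>c < c_upper\<close> puts \<open>p_lB\<close> where \<open>Act_l\<close> is strictly
  better.\<close>

lemma p_lB_less:
  assumes "c < c_upper"
  shows "p_lB < (lL - rL) / ((rR - lR) + (lL - rL))"
proof -
  let ?a = "rR - lR" and ?b = "lL - rL"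
  have ab: "?a > 0" "?b > 0" using payoff_R payoff_L by auto
  have "p_lB = c / (lam * ?a)" by (simp add: p_lB_def)
  also have "\<dots> < c_upper / (lam * ?a)"
    using assms ab rate_pos by (intro divide_strict_right_mono) auto
  also have "\<dots> = ?b / (?a + ?b)"
    unfolding c_upper_def using ab rate_pos by simp
  finally show ?thesis .
qed

lemma p_lB_less_1:
  assumes "c < c_upper"
  shows "p_lB < 1"
proof -
  have "(lL - rL) / ((rR - lR) + (lL - rL)) < 1"
    using payoff_R payoff_L by (simp add: divide_simps)
  then show ?thesis using p_lB_less[OF assms] by linarith
qed

lemma U_r_less_U_l_p_lB:
  assumes "c < c_upper"
  shows "U Act_r p_lB < U Act_l p_lB"
proof -
  have "p_lB * ((rR - lR) + (lL - rL)) < lL - rL"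
    using p_lB_less[OF assms] payoff_R payoff_L by (simp add: pos_less_divide_eq)
  then show ?thesis
    unfolding U_def by (simp add: algebra_simps)
qed

lemma U_l_antimono: "p \<le> q \<Longrightarrow> U Act_l q \<le> U Act_l p"
proof -
  assume "p \<le> q"
  then have "(q - p) * lR \<le> (q - p) * lL"
    using payoff_l by (intro mult_left_mono) auto
  then show ?thesis unfolding U_def by (simp add: algebra_simps)
qed

lemma U_r_strict_mono: "p < q \<Longrightarrow> U Act_r p < U Act_r q"
proof -
  assume "p < q"
  then have "(q - p) * rL < (q - p) * rR"
    using payoff_r by (intro mult_strict_left_mono) auto
  then show ?thesis unfolding U_def by (simp add: algebra_simps)
qed

section \<open>The Bayesian value and its optimal stopping threshold\<close>

lemma \<phi>_has_derivative:
  assumes "0 < p" "p < 1" "0 < x" "x < 1"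
  shows "((\<lambda>x. \<phi> p x (U Act_l x)) has_real_derivative
           (1 - p) / (1 - x)\<^sup>2 * (c / (lam * x) - (rR - lR))) (at x)"
proof -
  have "((\<lambda>x. ln (p / (1 - p) * ((1 - x) / x))) has_real_derivative - 1 / (x * (1 - x))) (at x)"
    using assms by (auto intro!: derivative_eq_intros simp: divide_simps) (simp add: algebra_simps)
  then show ?thesis
    unfolding \<phi>_def U_def using assms rate_pos
    by (auto intro!: derivative_eq_intros)
      (simp add: divide_simps, simp add: algebra_simps power2_eq_square)
qed

text \<open>The derivative in the threshold \<open>x\<close> has the sign of
  \<open>p_lB - x\<close>, so the value is single-peaked at \<open>p_lB\<close>; if \<open>p\<close>
  is smaller, the constraint \<open>x \<le> p\<close> binds.\<close>

lemma \<phi>_le: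
  assumes "c < c_upper" "0 < p" "p < 1" "0 < x" "x \<le> p"
  shows "\<phi> p x (U Act_l x) \<le> \<phi> p (min p p_lB) (U Act_l (min p p_lB))"
proof -
  note b = p_lB_pos p_lB_less_1[OF assms(1)]
  have d: "((\<lambda>x. \<phi> p x (U Act_l x)) has_real_derivative
           (1 - p) / (1 - y)\<^sup>2 * ((rR - lR) * (p_lB - y) / y)) (at y)" if "0 < y" "y < 1" for y
  proof -
    have "c / (lam * y) - (rR - lR) = (rR - lR) * (p_lB - y) / y"
    proof -
      have "c = lam * (p_lB * (rR - lR))"
        using p_lB_times rate_pos by (simp add: field_simps)
      then have "c / (lam * y) = p_lB * (rR - lR) / y"
        using rate_pos by (metis mult_divide_mult_cancel_left order_less_irrefl)
      then show ?thesis using that by (simp add: field_simps)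
    qed
    then show ?thesis using \<phi>_has_derivative[OF assms(2,3) that] by simp
  qed
  show ?thesis
  proof (cases "x \<le> min p p_lB")
    case True
    show ?thesis
    proof (rule DERIV_nonneg_imp_nondecreasing[OF True])
      fix y assume y: "x \<le> y" "y \<le> min p p_lB"
      then have "0 < y" "y < 1" using assms by auto
      moreover have "(1 - p) / (1 - y)\<^sup>2 * ((rR - lR) * (p_lB - y) / y) \<ge> 0"
        using y assms payoff_R by (intro mult_nonneg_nonneg divide_nonneg_nonneg) auto
      ultimately show "\<exists>z. ((\<lambda>x. \<phi> p x (U Act_l x)) has_real_derivative z) (at y) \<and> 0 \<le> z"
        using d by blast
    qed
  next
    case False
    then have m: "min p p_lB = p_lB" "p_lB \<le> x" using assms by auto
    show ?thesis
      unfolding m(1)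
    proof (rule DERIV_nonpos_imp_nonincreasing[OF m(2)])
      fix y assume y: "p_lB \<le> y" "y \<le> x"
      then have "0 < y" "y < 1" using assms b by auto
      moreover have "(1 - p) / (1 - y)\<^sup>2 * ((rR - lR) * (p_lB - y) / y) \<le> 0"
        using y assms payoff_R \<open>0 < y\<close>
        by (intro mult_nonneg_nonpos divide_nonpos_nonneg mult_nonneg_nonpos) auto
      ultimately show "\<exists>z. ((\<lambda>x. \<phi> p x (U Act_l x)) has_real_derivative z) (at y) \<and> z \<le> 0"
        using d by blast
    qed
  qed
qed

lemma \<Phi>_interior:
  assumes "c < c_upper" "0 < p" "p < 1"
  shows "\<Phi> p = \<phi> p (min p p_lB) (U Act_l (min p p_lB))"
proof -
  have "(SUP p'\<in>{0<..p}. \<phi> p p' (U Act_l p')) = \<phi> p (min p p_lB) (U Act_l (min p p_lB))"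
    by (rule cSup_eq_maximum) (use assms p_lB_pos \<phi>_le[OF assms] in auto)
  then show ?thesis using assms by (simp add: \<Phi>_def)
qed

lemma \<Phi>_eq_U_l:
  assumes "c < c_upper" "0 \<le> p" "p \<le> p_lB"
  shows "\<Phi> p = U Act_l p"
proof (cases "p = 0")
  case False
  then have "0 < p" "p < 1" "min p p_lB = p" using assms p_lB_less_1[OF assms(1)] by auto
  moreover have "p / (1 - p) * ((1 - p) / p) = 1" using \<open>0 < p\<close> \<open>p < 1\<close> by simp
  ultimately show ?thesis
    using \<Phi>_interior[OF assms(1)] by (simp add: \<phi>_def)
qed (simp add: \<Phi>_def)

lemma \<Phi>_ge_U_l:
  assumes "c < c_upper" "0 < p" "p < 1"
  shows "U Act_l p \<le> \<Phi> p"
proof -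
  have "p / (1 - p) * ((1 - p) / p) = 1" using assms by simp
  then have "\<phi> p p (U Act_l p) = U Act_l p" using assms by (simp add: \<phi>_def)
  then show ?thesis
    using \<phi>_le[OF assms assms(2) order.refl] \<Phi>_interior[OF assms] by simp
qed

lemma \<Phi>_eq_\<psi>:
  assumes "c < c_upper" "p_lB \<le> p" "p \<le> 1"
  shows "\<Phi> p = \<psi> p"
proof (cases "p = 1")
  case True
  \<comment> \<open>By \<open>p_lB < 1\<close>, experimenting beats \<open>Act_l\<close> in
    \<open>World_R\<close>, so the maximum in the definition of \<open>\<Phi>\<close> at 1 is
    \<open>\<psi> 1\<close>.\<close>
  have "lR \<le> rR - c / lam"
  proof -
    have "p_lB * (rR - lR) \<le> 1 * (rR - lR)"
      using p_lB_less_1[OF assms(1)] payoff_R by (intro mult_right_mono) auto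
    then show ?thesis using p_lB_times by simp
  qed
  then show ?thesis
    using True p_lB_less_1[OF assms(1)] by (simp add: \<Phi>_def \<psi>_def \<phi>_def U_def)
next
  case False
  then show ?thesis
    using assms p_lB_pos \<Phi>_interior[OF assms(1), of p] by (simp add: \<psi>_def min_def)
qed

text \<open>Bellman equation of experimentation: the gain \<open>p * (rR - \<psi> p)\<close> from a
  breakthrough, net of the cost, equals the loss from the downward drift of the belief.\<close>

lemma \<psi>_has_derivative:
  assumes "c < c_upper" "0 < p" "p < 1"
  shows "(\<psi> has_real_derivative (p * (rR - \<psi> p) - c / lam) / (p * (1 - p))) (at p)"
proof -
  define b where "b = p_lB"
  define v where "v = U Act_l p_lB"
  have b: "0 < b" "b < 1" using p_lB_pos p_lB_less_1[OF assms(1)] by (auto simp: b_def)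
  define L where "L = (\<lambda>p. ln (p / (1 - p) * ((1 - b) / b)))"
  have L: "(L has_real_derivative 1 / (p * (1 - p))) (at p)"
    unfolding L_def using assms b
    by (auto intro!: derivative_eq_intros simp: divide_simps) (simp add: algebra_simps)
  have eq: "\<psi> = (\<lambda>p. (p - b) / (1 - b) * rR + (1 - p) / (1 - b) * v
      - ((p - b) / (1 - b) + (1 - p) * L p) * (c / lam))"
    by (rule ext) (simp add: \<psi>_def \<phi>_def L_def b_def v_def)
  show ?thesis
    unfolding eq using assms b rate_pos
    by (auto intro!: derivative_eq_intros L) (simp add: divide_simps, simp add: algebra_simps)
qed

lemma continuous_on_\<psi>:
  assumes "c < c_upper"
  shows "continuous_on {p_lB..1} \<psi>"
proof -
  define b where "b = p_lB"
  define k where "k = (1 - b) / b"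
  have b: "0 < b" "b < 1" using p_lB_pos p_lB_less_1[OF assms(1)] by (auto simp: b_def)
  then have k: "k > 0" by (simp add: k_def)
  \<comment> \<open>Only the endpoint 1 is delicate: there the logarithm diverges but is dominated
    by the factor \<open>1 - p\<close>.\<close>
  have "((\<lambda>p. (1 - p) * ln (p / (1 - p) * k)) \<longlongrightarrow> 0) (at_left 1)"
    using k by real_asymp
  then have "(\<psi> \<longlongrightarrow> (1 - b) / (1 - b) * rR + (1 - 1) / (1 - b) * U Act_l b
      - ((1 - b) / (1 - b) + 0) * (c / lam)) (at_left 1)"
    unfolding \<psi>_def \<phi>_def b_def[symmetric] k_def[symmetric]
    by (intro tendsto_intros) (use b in auto)
  then have "(\<psi> \<longlongrightarrow> \<psi> 1) (at_left 1)"
    unfolding \<psi>_def \<phi>_def b_def[symmetric] by simp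
  then have 1: "continuous (at 1 within {p_lB..1}) \<psi>"
    using b by (simp add: continuous_within at_within_Icc_at_left b_def)
  show ?thesis
    unfolding continuous_on_eq_continuous_within
  proof
    fix p assume "p \<in> {p_lB..1}"
    then consider "p = 1" | "0 < p" "p < 1"
      using p_lB_pos by fastforce
    then show "continuous (at p within {p_lB..1}) \<psi>"
      using 1 by cases (auto intro: continuous_at_imp_continuous_at_within DERIV_isCont
          \<psi>_has_derivative[OF assms])
  qed
qed

section \<open>Location of the minimizer \<open>p_star\<close>\<close>

lemma \<Phi>_star_attains_min:
  assumes "c < c_upper"
  obtains p where "p \<in> {0..1}" "\<And>x. x \<in> {0..1} \<Longrightarrow> \<Phi>_star p \<le> \<Phi>_star x"
proof -
  note b = p_lB_pos p_lB_less_1[OF assms]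
  have "continuous_on {p_lB..1} (\<lambda>p. max (\<psi> p) (U Act_r p))"
    unfolding U_def by (intro continuous_intros continuous_on_\<psi> assms)
  then have "continuous_on {p_lB..1} \<Phi>_star"
    by (rule continuous_on_eq) (simp add: \<Phi>_star_def \<Phi>_eq_\<psi> assms)
  then obtain p where p: "p \<in> {p_lB..1}" "\<And>x. x \<in> {p_lB..1} \<Longrightarrow> \<Phi>_star p \<le> \<Phi>_star x"
    using continuous_attains_inf[of "{p_lB..1}" \<Phi>_star] b by auto
  show thesis
  proof
    show "p \<in> {0..1}" using p b by simp
    fix x :: real assume x: "x \<in> {0..1}"
    show "\<Phi>_star p \<le> \<Phi>_star x"
    \<comment> \<open>Below \<open>p_lB\<close> the Bayesian value is the decreasing line
      \<open>U Act_l\<close>, so the compact interval from \<open>p_lB\<close> to 1 already contains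
      a minimizer.\<close>
    proof (cases "p_lB \<le> x")
      case False
      have "\<Phi>_star p \<le> \<Phi>_star p_lB" using p b by simp
      also have "\<dots> = U Act_l p_lB"
        using \<Phi>_eq_U_l[OF assms, of p_lB] b U_r_less_U_l_p_lB[OF assms] by (simp add: \<Phi>_star_def)
      also have "\<dots> \<le> U Act_l x" using False by (intro U_l_antimono) simp
      also have "\<dots> \<le> \<Phi>_star x"
        using \<Phi>_eq_U_l[OF assms, of x] x False by (simp add: \<Phi>_star_def)
      finally show ?thesis .
    qed (use p x in simp)
  qed
qed

text \<open>\<open>p_star\<close> is picked by a choice operator, which says something only once a
  minimum is known to exist.\<close>

lemma p_star_minimizes:
  assumes "c < c_upper"
  shows "p_star \<in> {0..1}" and "x \<in> {0..1} \<Longrightarrow> \<Phi>_star p_star \<le> \<Phi>_star x"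
proof -
  obtain p where p: "p \<in> {0..1}" "\<And>x. x \<in> {0..1} \<Longrightarrow> \<Phi>_star p \<le> \<Phi>_star x"
    by (rule \<Phi>_star_attains_min[OF assms]) blast
  have "p_star \<in> {0..1} \<and> (\<forall>x\<in>{0..1}. \<Phi>_star p_star \<le> \<Phi>_star x)"
    unfolding p_star_def arg_min_on_def
    by (rule arg_minI[of _ p]) (use p in \<open>auto simp: not_less\<close>)
  then show "p_star \<in> {0..1}" and "x \<in> {0..1} \<Longrightarrow> \<Phi>_star p_star \<le> \<Phi>_star x"
    by auto
qed

text \<open>Smooth pasting: at \<open>p_lB\<close>, \<open>\<psi>\<close> has the slope
  \<open>- (lL - lR)\<close> of \<open>U Act_l\<close>, while \<open>U Act_r\<close> is strictly
  lower. Hence \<open>\<Phi>_star\<close> still falls just to the right of \<open>p_lB\<close>,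
  whereas up to \<open>p_lB\<close> it is at least \<open>U Act_l p_lB\<close>.\<close>

lemma p_star_greater_p_lB: "p_lB < p_star"
  and \<Phi>_p_star_less: "\<Phi> p_star < U Act_l p_lB"
  if c: "c < c_upper"
proof -
  note b = p_lB_pos p_lB_less_1[OF c]
  note min = p_star_minimizes[OF c]
  have \<psi>_b: "\<psi> p_lB = U Act_l p_lB"
    using \<Phi>_eq_\<psi>[OF c, of p_lB] \<Phi>_eq_U_l[OF c, of p_lB] b by simp
  have "p_lB * (rR - \<psi> p_lB) - c / lam = - (p_lB * (1 - p_lB) * (lL - lR))"
    unfolding \<psi>_b using p_lB_times by (simp add: U_def algebra_simps)
  also have "\<dots> < 0" using b payoff_l by simp
  finally have "(p_lB * (rR - \<psi> p_lB) - c / lam) / (p_lB * (1 - p_lB)) < 0"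
    using b by (simp add: divide_neg_pos)
  then obtain e where e: "e > 0" "\<And>h. 0 < h \<Longrightarrow> h < e \<Longrightarrow> \<psi> (p_lB + h) < \<psi> p_lB"
    using DERIV_neg_dec_right[OF \<psi>_has_derivative[OF c]] b by blast
  have "isCont (U Act_r) p_lB"
    unfolding U_def by (intro continuous_intros)
  then have "\<forall>\<^sub>F x in at p_lB. U Act_r x < U Act_l p_lB"
    using U_r_less_U_l_p_lB[OF c] by (simp add: isCont_def order_tendsto_iff)
  then obtain e' where e': "e' > 0"
    "\<And>x. x \<noteq> p_lB \<Longrightarrow> dist x p_lB < e' \<Longrightarrow> U Act_r x < U Act_l p_lB"
    unfolding eventually_at by auto
  obtain h where h: "0 < h" "h < e" "h < e'" "h < 1 - p_lB"
    using field_lbound_gt_zero[of "min e e'" "1 - p_lB"] e e' b by auto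
  have "\<Phi>_star (p_lB + h) < U Act_l p_lB"
    using h e(2)[of h] e'(2)[of "p_lB + h"] \<psi>_b b \<Phi>_eq_\<psi>[OF c, of "p_lB + h"]
    by (simp add: \<Phi>_star_def dist_real_def)
  then have lt: "\<Phi>_star p_star < U Act_l p_lB"
    using min(2)[of "p_lB + h"] h b by simp
  then show "\<Phi> p_star < U Act_l p_lB"
    by (simp add: \<Phi>_star_def)
  show "p_lB < p_star"
  proof (rule ccontr)
    assume "\<not> p_lB < p_star"
    then have "U Act_l p_lB \<le> \<Phi> p_star"
      using \<Phi>_eq_U_l[OF c, of p_star] min(1) U_l_antimono[of p_star p_lB] by simp
    then show False using \<open>\<Phi> p_star < U Act_l p_lB\<close> by simp
  qed
qed

text \<open>At 1, \<open>U Act_r\<close> equals \<open>rR\<close>, whereas just below 1 both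
  \<open>U Act_r\<close> and \<open>\<psi>\<close> are smaller, as \<open>\<psi>\<close> falls short
  of \<open>rR\<close> by about \<open>c / lam\<close> there.\<close>

lemma p_star_less_1:
  assumes c: "c < c_upper"
  shows "p_star < 1"
proof (rule ccontr)
  note b = p_lB_pos p_lB_less_1[OF c]
  assume "\<not> p_star < 1"
  then have [simp]: "p_star = 1" using p_star_minimizes(1)[OF c] by simp
  have \<psi>1: "\<psi> 1 < rR"
    using b cost_pos rate_pos by (simp add: \<psi>_def \<phi>_def)
  have "(\<psi> \<longlongrightarrow> \<psi> 1) (at_left 1)"
  proof -
    have "continuous (at 1 within {p_lB..1}) \<psi>"
      using continuous_on_\<psi>[OF c] b by (simp add: continuous_on_eq_continuous_within)
    then show ?thesis
      using b by (simp add: continuous_within at_within_Icc_at_left)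
  qed
  then have "\<forall>\<^sub>F x in at_left 1. \<psi> x < rR"
    using \<psi>1 by (simp add: order_tendsto_iff)
  moreover have "\<forall>\<^sub>F x in at_left 1. p_lB < x \<and> x < (1::real)"
    using b eventually_at_left[of p_lB 1] by auto
  ultimately have "\<forall>\<^sub>F x in at_left 1. \<psi> x < rR \<and> p_lB < x \<and> x < (1::real)"
    by eventually_elim simp
  then obtain x where x: "\<psi> x < rR" "p_lB < x" "x < 1"
    using eventually_happens'[OF trivial_limit_at_left_real] by blast
  have "U Act_r x < rR"
    using U_r_strict_mono[OF x(3)] by (simp add: U_def)
  then have "\<Phi>_star x < rR"
    using x b \<Phi>_eq_\<psi>[OF c, of x] by (simp add: \<Phi>_star_def)
  moreover have "rR \<le> \<Phi>_star 1"
    by (simp add: \<Phi>_star_def U_def)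
  ultimately show False
    using p_star_minimizes(2)[OF c, of x] x b by simp
qed

lemma \<Phi>_has_derivative_p_star:
  assumes c: "c < c_upper"
  shows "(\<Phi> has_real_derivative (p_star * (rR - \<Phi> p_star) - c / lam) / (p_star * (1 - p_star)))
           (at p_star)"
proof -
  note b = p_lB_pos p_star_greater_p_lB[OF c] p_star_less_1[OF c]
  have [simp]: "\<psi> p_star = \<Phi> p_star" using b by (simp add: \<Phi>_eq_\<psi> c)
  have "(\<psi> has_real_derivative (p_star * (rR - \<Phi> p_star) - c / lam) / (p_star * (1 - p_star)))
      (at p_star)"
    using \<psi>_has_derivative[OF c, of p_star] b by simp
  then show ?thesis
    by (rule has_field_derivative_transform_within_open[of _ _ _ "{p_lB<..<1}"])
      (use b in \<open>auto simp: \<Phi>_eq_\<psi> c\<close>)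
qed

(* At a minimum of max \<Phi> (U Act_r) the left neighbours cannot have a smaller \<Phi>,
   since they have a smaller U Act_r. *)
lemma \<Phi>_p_star_ode_nonpos:
  assumes c: "c < c_upper"
  shows "p_star * (rR - \<Phi> p_star) - c / lam \<le> 0"
proof (rule ccontr)
  note b = p_lB_pos p_star_greater_p_lB[OF c] p_star_less_1[OF c]
  assume "\<not> ?thesis"
  then have "0 < (p_star * (rR - \<Phi> p_star) - c / lam) / (p_star * (1 - p_star))"
    using b by simp
  then obtain e where e: "e > 0" "\<And>h. 0 < h \<Longrightarrow> h < e \<Longrightarrow> \<Phi> (p_star - h) < \<Phi> p_star"
    using DERIV_pos_inc_left[OF \<Phi>_has_derivative_p_star[OF c]] by blast
  obtain h where h: "0 < h" "h < e" "h < p_star"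
    using field_lbound_gt_zero[of e p_star] e b by auto
  then have "\<Phi>_star (p_star - h) < \<Phi>_star p_star"
    using e(2)[of h] U_r_strict_mono[of "p_star - h" p_star] by (auto simp: \<Phi>_star_def max_def)
  then show False
    using p_star_minimizes(2)[OF c, of "p_star - h"] h b by simp
qed

end

section \<open>The value in the randomization region\<close>

context wald_problem
begin

text \<open>Square root of the discriminant of
  \<open>(rR - v) * (lL - v) - (lL - lR) * (c / lam)\<close>. The zeros \<open>V_lo\<close> and
  \<open>V_hi\<close> of this quadratic are the constant solutions of the value equation.\<close>

definition V_disc :: real where
  "V_disc = sqrt ((rR - lL)\<^sup>2 + 4 * ((lL - lR) * (c / lam)))"

definition V_lo :: real where
  "V_lo = (rR + lL - V_disc) / 2"

definition V_hi :: real where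
  "V_hi = (rR + lL + V_disc) / 2"

definition V_rhs :: "real \<Rightarrow> real" where
  "V_rhs v = (rR - v) * (lL - v) / (lL - lR) - c / lam"

lemma V_lo_less_V_hi: "V_lo < V_hi"
proof -
  have "0 < (rR - lL)\<^sup>2 + 4 * ((lL - lR) * (c / lam))"
    using payoff_l cost_pos rate_pos by (intro add_nonneg_pos) auto
  then show ?thesis by (simp add: V_lo_def V_hi_def V_disc_def)
qed

lemma V_rhs_factor: "V_rhs v = (v - V_lo) * (v - V_hi) / (lL - lR)"
proof -
  have "0 \<le> (rR - lL)\<^sup>2 + 4 * ((lL - lR) * (c / lam))"
    using payoff_l cost_pos rate_pos by auto
  then have "V_disc\<^sup>2 = (rR - lL)\<^sup>2 + 4 * ((lL - lR) * (c / lam))"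
    by (simp add: V_disc_def)
  then have "(v - V_lo) * (v - V_hi) = (rR - v) * (lL - v) - (lL - lR) * (c / lam)"
    unfolding V_lo_def V_hi_def by (simp add: field_simps power2_eq_square)
  then show ?thesis
    unfolding V_rhs_def using payoff_l by (simp add: diff_divide_distrib)
qed

lemma V_rhs_nonpos_iff: "V_rhs v \<le> 0 \<longleftrightarrow> V_lo \<le> v \<and> v \<le> V_hi"
  unfolding V_rhs_factor using payoff_l V_lo_less_V_hi
  by (auto simp: divide_le_0_iff mult_le_0_iff)

text \<open>\<open>V_rhs\<close> is positive at \<open>lR\<close>, because \<open>p_lB < 1\<close>,
  and not at \<open>lL\<close>; so \<open>lL\<close> lies between the zeros and the smaller number
  \<open>lR\<close> below both. Later this keeps indifference beliefs away from 1.\<close>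

lemma V_lo_greater:
  assumes "c < c_upper"
  shows "lR < V_lo"
proof (rule ccontr)
  have "p_lB * (rR - lR) < 1 * (rR - lR)"
    using p_lB_less_1[OF assms] payoff_R by (intro mult_strict_right_mono) auto
  then have "0 < V_rhs lR"
    using payoff_l by (simp add: V_rhs_def p_lB_times)
  moreover have "V_rhs lL \<le> 0"
    using cost_pos rate_pos by (simp add: V_rhs_def)
  moreover assume "\<not> lR < V_lo"
  ultimately show False
    using V_rhs_nonpos_iff[of lL] V_rhs_nonpos_iff[of lR] payoff_l by auto
qed

text \<open>Multiplying \<open>\<Phi> p_star \<ge> U Act_l p_star\<close> by the nonnegative
  \<open>rR - \<Phi> p_star\<close> bounds the quotient in \<open>V_rhs\<close> by
  \<open>p_star * (rR - \<Phi> p_star)\<close>, which is at most \<open>c / lam\<close> at the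
  minimizer.\<close>

lemma V_lo_le_\<Phi>_p_star: "V_lo \<le> \<Phi> p_star"
  and \<Phi>_p_star_le_V_hi: "\<Phi> p_star \<le> V_hi"
  if c: "c < c_upper" and r: "\<Phi> p_star \<le> rR"
proof -
  note b = p_lB_pos p_star_greater_p_lB[OF c] p_star_less_1[OF c]
  have "lL - \<Phi> p_star \<le> p_star * (lL - lR)"
    using \<Phi>_ge_U_l[OF c, of p_star] b by (simp add: U_def algebra_simps)
  then have "(rR - \<Phi> p_star) * (lL - \<Phi> p_star) \<le> (rR - \<Phi> p_star) * (p_star * (lL - lR))"
    using r by (intro mult_left_mono) auto
  then have "(rR - \<Phi> p_star) * (lL - \<Phi> p_star) / (lL - lR) \<le> p_star * (rR - \<Phi> p_star)"
    using payoff_l by (subst pos_divide_le_eq) (simp_all add: mult_ac)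
  then have "V_rhs (\<Phi> p_star) \<le> 0"
    unfolding V_rhs_def using \<Phi>_p_star_ode_nonpos[OF c] by linarith
  then show "V_lo \<le> \<Phi> p_star" "\<Phi> p_star \<le> V_hi"
    by (auto simp: V_rhs_nonpos_iff)
qed

section \<open>Existence, bounds and monotonicity of \<open>V_hat\<close>\<close>

lemma ex_solves_V_ode:
  assumes c: "c < c_upper" and r: "\<Phi> p_star \<le> rR"
  shows "\<exists>V. solves_V_ode V"
proof -
  note b = p_lB_pos p_star_greater_p_lB[OF c] p_star_less_1[OF c]
  (* In log odds the equation is a Riccati equation with constant coefficients, along whose
     solutions (v - V_lo) / (V_hi - v) decays exponentially at rate k. *)
  define A B where "A = V_hi - \<Phi> p_star" and "B = \<Phi> p_star - V_lo"
  have AB: "0 \<le> A" "0 \<le> B" "0 < A + B"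
    using V_lo_le_\<Phi>_p_star[OF assms] \<Phi>_p_star_le_V_hi[OF assms] V_lo_less_V_hi
    by (auto simp: A_def B_def)
  define k where "k = (V_hi - V_lo) / (lL - lR)"
  define E where "E = (\<lambda>p. exp (k * (log_odds p - log_odds p_star)))"
  define V where "V = (\<lambda>p. (V_lo * A * E p + V_hi * B) / (A * E p + B))"
  define V' where "V' = (\<lambda>p. V_rhs (V p) / (p * (1 - p)))"
  have E: "(E has_real_derivative k * E p / (p * (1 - p))) (at p within S)"
    if "0 < p" "p < 1" for p S
    unfolding E_def using that
    by (auto intro!: derivative_eq_intros log_odds_has_derivative)
  \<comment> \<open>\<open>V\<close> is a weighted mean of \<open>V_lo\<close> and
    \<open>V_hi\<close>; as the start lies between the zeros, the weights are nonnegative with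
    positive sum and there is no pole, even if \<open>V\<close> degenerates to a constant.\<close>
  have M: "0 < A * E p + B" for p
  proof -
    have "0 < E p" by (simp add: E_def)
    then show ?thesis
      using AB by (cases "B = 0") (auto intro!: add_nonneg_pos)
  qed
  have "(V has_real_derivative V' p) (at p within S)" if p: "0 < p" "p < 1" for p S
  proof -
    have m: "A * E p + B \<noteq> 0" using M[of p] by simp
    have "(V has_real_derivative
        (V_lo * A * (k * E p / (p * (1 - p))) * (A * E p + B)
         - (V_lo * A * E p + V_hi * B) * (A * (k * E p / (p * (1 - p))))) / (A * E p + B)\<^sup>2)
        (at p within S)"
      unfolding V_def
      by (rule derivative_eq_intros E p m | simp add: m power2_eq_square mult_ac)+
    moreover have "V p - V_lo = (V_hi - V_lo) * B / (A * E p + B)"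
      "V p - V_hi = - ((V_hi - V_lo) * A * E p / (A * E p + B))"
      unfolding V_def using m by (simp_all add: field_simps)
    then have "V_rhs (V p) = - (k * (V_hi - V_lo) * A * B * E p / (A * E p + B)\<^sup>2)"
      unfolding V_rhs_factor k_def by (simp add: power2_eq_square mult_ac)
    then have "V' p = - (k * (V_hi - V_lo) * A * B * E p / (A * E p + B)\<^sup>2) / (p * (1 - p))"
      by (simp add: V'_def)
    moreover have "\<dots> = (V_lo * A * (k * E p / (p * (1 - p))) * (A * E p + B)
         - (V_lo * A * E p + V_hi * B) * (A * (k * E p / (p * (1 - p))))) / (A * E p + B)\<^sup>2"
      using m p by (simp add: divide_simps) (simp add: algebra_simps)
    ultimately show ?thesis by simp
  qed
  moreover have "V p_star = \<Phi> p_star"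
  proof -
    have "V_lo * A + V_hi * B = \<Phi> p_star * (A + B)"
      by (simp add: A_def B_def algebra_simps)
    then show ?thesis
      using AB by (simp add: V_def E_def)
  qed
  ultimately have "solves_V_ode V"
    unfolding solves_V_ode_def V_rhs_def[symmetric]
    using b by (intro conjI exI[of _ V']) (auto simp: V'_def)
  then show ?thesis by blast
qed

end

text \<open>The derivative condition at \<open>p_star\<close> enters through
  \<open>\<Phi> p_star \<le> rR\<close>, which makes the stopping rate nonnegative and starts
  \<open>V_hat\<close> between the zeros.\<close>

locale wald_equilibrium = wald_problem +
  assumes c_less: "c < c_upper"
    and \<Phi>_p_star_le: "\<Phi> p_star \<le> rR"
begin

lemma p_star_bounds: "0 < p_star" "p_star < 1"
  using p_lB_pos p_star_greater_p_lB[OF c_less] p_star_less_1[OF c_less] by auto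

lemma V_hat_p_star: "V_hat p_star = \<Phi> p_star"
  and V_hat_has_derivative: "p \<in> {p_star..<1} \<Longrightarrow>
    (V_hat has_real_derivative V_rhs (V_hat p) / (p * (1 - p))) (at p within {p_star..<1})"
proof -
  have "solves_V_ode V_hat"
    unfolding V_hat_def using someI_ex[OF ex_solves_V_ode[OF c_less \<Phi>_p_star_le]] .
  then have V0: "V_hat p_star = \<Phi> p_star"
    and "\<exists>V'. \<forall>p\<in>{p_star..<1}.
      (V_hat has_real_derivative V' p) (at p within {p_star..<1}) \<and> p * (1 - p) * V' p = V_rhs (V_hat p)"
    unfolding solves_V_ode_def V_rhs_def[symmetric] by (rule conjunct1, rule conjunct2)
  then obtain V' where V: "\<forall>p\<in>{p_star..<1}.
      (V_hat has_real_derivative V' p) (at p within {p_star..<1}) \<and> p * (1 - p) * V' p = V_rhs (V_hat p)"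
    by (elim exE)
  show "V_hat p_star = \<Phi> p_star" by (rule V0)
  assume p: "p \<in> {p_star..<1}"
  then have "V' p = V_rhs (V_hat p) / (p * (1 - p))"
    using bspec[OF V p] p p_star_bounds by (subst nonzero_eq_divide_eq) (auto simp: mult.commute)
  then show "(V_hat has_real_derivative V_rhs (V_hat p) / (p * (1 - p))) (at p within {p_star..<1})"
    using bspec[OF V p] by simp
qed

lemma continuous_on_V_hat: "continuous_on {p_star..<1} V_hat"
  by (rule DERIV_continuous_on[OF V_hat_has_derivative])

text \<open>Freezing one factor of \<open>V_rhs\<close> in the coefficient gives a linear equation
  for the distance to the other zero, whose sign is therefore preserved. This covers whichever
  solution \<open>V_hat\<close> is.\<close>

lemma V_hat_bounds:
  assumes p: "p_star \<le> p" "p < 1"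
  shows "V_lo \<le> V_hat p" "V_hat p \<le> V_hi"
proof -
  have cont: "continuous_on {p_star..p} V_hat"
    by (rule continuous_on_subset[OF continuous_on_V_hat]) (use p in auto)
  have der: "(V_hat has_real_derivative V_rhs (V_hat t) / (t * (1 - t))) (at t within {p_star..p})"
    if "t \<in> {p_star..p}" for t
    by (rule DERIV_subset[OF V_hat_has_derivative]) (use p that in auto)
  define k where "k = (\<lambda>v t. (V_hat t - v) / ((lL - lR) * (t * (1 - t))))"
  have k: "continuous_on {p_star..p} (k v)" for v
    unfolding k_def
  proof (intro continuous_intros cont ballI)
    fix t assume "t \<in> {p_star..p}"
    then show "(lL - lR) * (t * (1 - t)) \<noteq> 0"
      using p p_star_bounds payoff_l by simp
  qed
  have der': "((\<lambda>t. V_hat t - v) has_real_derivative k w t * (V_hat t - v)) (at t within {p_star..p})"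
    if "t \<in> {p_star..p}" and "V_rhs (V_hat t) = (V_hat t - w) * (V_hat t - v) / (lL - lR)" for v w t
  proof -
    have "V_rhs (V_hat t) / (t * (1 - t)) - 0 = k w t * (V_hat t - v)"
      unfolding that(2) k_def by simp
    then show ?thesis
      using DERIV_diff[OF der[OF that(1)] DERIV_const[of v]] by simp
  qed
  have "V_hat p - V_lo = (V_hat p_star - V_lo) * exp (integral {p_star..p} (k V_hi))"
    using linear_ode_eq[where f = "\<lambda>t. V_hat t - V_lo", OF p(1) k der'[where v = V_lo and w = V_hi]]
    by (simp add: V_rhs_factor mult.commute)
  moreover have "0 \<le> (V_hat p_star - V_lo) * exp (integral {p_star..p} (k V_hi))"
    using V_lo_le_\<Phi>_p_star[OF c_less \<Phi>_p_star_le] V_hat_p_star by simp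
  ultimately show "V_lo \<le> V_hat p" by linarith
  have "V_hat p - V_hi = (V_hat p_star - V_hi) * exp (integral {p_star..p} (k V_lo))"
    using linear_ode_eq[where f = "\<lambda>t. V_hat t - V_hi", OF p(1) k der'[where v = V_hi and w = V_lo]]
    by (simp add: V_rhs_factor mult.commute)
  moreover have "(V_hat p_star - V_hi) * exp (integral {p_star..p} (k V_lo)) \<le> 0"
    using \<Phi>_p_star_le_V_hi[OF c_less \<Phi>_p_star_le] V_hat_p_star by (simp add: mult_le_0_iff)
  ultimately show "V_hat p \<le> V_hi" by linarith
qed

lemma V_hat_has_derivative_at:
  assumes "p_star < p" "p < 1"
  shows "(V_hat has_real_derivative V_rhs (V_hat p) / (p * (1 - p))) (at p)"
  using V_hat_has_derivative[of p] assms at_within_interior[of p "{p_star..<1}"] by simp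

lemma V_hat_antimono:
  assumes "p_star \<le> p" "p \<le> q" "q < 1"
  shows "V_hat q \<le> V_hat p"
proof (rule DERIV_nonpos_imp_decreasing_open[OF assms(2)])
  fix x assume x: "p < x" "x < q"
  then have "(V_hat has_real_derivative V_rhs (V_hat x) / (x * (1 - x))) (at x)"
    using assms by (intro V_hat_has_derivative_at) auto
  moreover have "V_rhs (V_hat x) / (x * (1 - x)) \<le> 0"
    using x assms V_hat_bounds[of x] p_star_bounds
    by (intro divide_nonpos_nonneg) (auto simp: V_rhs_nonpos_iff)
  ultimately show "\<exists>y. (V_hat has_real_derivative y) (at x) \<and> y \<le> 0" by blast
next
  show "continuous_on {p..q} V_hat"
    by (rule continuous_on_subset[OF continuous_on_V_hat]) (use assms in auto)
qed

section \<open>The indifference belief \<open>q_hat\<close> and the boundary of the randomization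
  region\<close>

definition q_hat :: "real \<Rightarrow> real" where
  "q_hat p = (lL - V_hat p) / (lL - lR)"

lemma U_l_q_hat: "U Act_l (q_hat p) = V_hat p"
proof -
  have "q_hat p * (lL - lR) = lL - V_hat p"
    using payoff_l by (simp add: q_hat_def)
  then show ?thesis by (simp add: U_def algebra_simps)
qed

lemma U_l_less_iff: "U Act_l p < U Act_l q \<longleftrightarrow> q < p"
proof -
  have "U Act_l q - U Act_l p = (p - q) * (lL - lR)"
    by (simp add: U_def algebra_simps)
  then show ?thesis
    using payoff_l by (smt (verit) mult_pos_pos mult_nonpos_nonneg)
qed

lemma q_hat_mono:
  assumes "p_star \<le> p" "p \<le> q" "q < 1"
  shows "q_hat p \<le> q_hat q"
  using V_hat_antimono[OF assms] payoff_l by (simp add: q_hat_def divide_right_mono)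

lemma q_hat_greater:
  assumes "p_star \<le> p" "p < 1"
  shows "p_lB < q_hat p"
proof -
  have "U Act_l (q_hat p) < U Act_l p_lB"
    using \<Phi>_p_star_less[OF c_less] V_hat_antimono[of p_star p] assms
    by (simp add: U_l_q_hat V_hat_p_star)
  then show ?thesis by (simp add: U_l_less_iff)
qed

text \<open>The belief at which \<open>Act_l\<close> is worth \<open>V_lo\<close>: a bound on
  \<open>q_hat\<close>, uniform in the state and below 1, which makes \<open>G\<close> unbounded
  near 1.\<close>

definition q_max :: real where
  "q_max = (lL - V_lo) / (lL - lR)"

lemma q_max_less_1: "q_max < 1"
  using V_lo_greater[OF c_less] payoff_l by (simp add: q_max_def)

lemma q_hat_le_q_max:
  assumes "p_star \<le> p" "p < 1"
  shows "q_hat p \<le> q_max"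
  using V_hat_bounds(1)[OF assms] payoff_l by (simp add: q_hat_def q_max_def divide_right_mono)

lemma q_hat_bounds:
  assumes "p_star \<le> p" "p < 1"
  shows "0 < q_hat p" "q_hat p < 1"
  using q_hat_greater[OF assms] q_hat_le_q_max[OF assms] q_max_less_1 p_lB_pos by auto

definition G :: "real \<Rightarrow> real" where
  "G p = log_odds p - log_odds (q_hat p)"

lemma continuous_on_G: "continuous_on {p_star..<1} G"
proof -
  have lo: "continuous_on {0<..<1} log_odds"
    by (rule DERIV_continuous_on[OF log_odds_has_derivative]) auto
  have q: "continuous_on {p_star..<1} q_hat"
    unfolding q_hat_def using payoff_l by (intro continuous_intros continuous_on_V_hat) auto
  show ?thesis
    unfolding G_def
    by (intro continuous_intros continuous_on_compose2[OF lo q] continuous_on_subset[OF lo])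
      (use p_star_bounds q_hat_bounds in auto)
qed

text \<open>In log odds \<open>q_hat\<close> rises more slowly than the state: up to a positive
  factor the derivative of \<open>G\<close> is \<open>(q - p_lB) * (rR - lR)\<close> at
  \<open>q = q_hat p\<close>, and \<open>q_hat\<close> stays above \<open>p_lB\<close>.\<close>

lemma G_strict_mono:
  assumes "p_star \<le> p" "p < q" "q < 1"
  shows "G p < G q"
proof (rule DERIV_pos_imp_increasing_open[OF assms(2)])
  fix x assume x: "p < x" "x < q"
  then have x': "p_star < x" "x < 1" "0 < x" using assms p_star_bounds by auto
  let ?q = "q_hat x"
  have q: "0 < ?q" "?q < 1" "p_lB < ?q"
    using q_hat_bounds q_hat_greater x' by auto
  have "(q_hat has_real_derivative - (V_rhs (V_hat x) / (x * (1 - x))) / (lL - lR)) (at x)"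
    unfolding q_hat_def
    by (rule DERIV_cdivide) (auto intro!: derivative_eq_intros V_hat_has_derivative_at x')
  then have "((\<lambda>x. log_odds (q_hat x)) has_real_derivative
      1 / (?q * (1 - ?q)) * (- (V_rhs (V_hat x) / (x * (1 - x))) / (lL - lR))) (at x)"
    by (rule DERIV_chain2[where f = log_odds and g = q_hat, OF log_odds_has_derivative[OF q(1,2)]])
  then have "(G has_real_derivative 1 / (x * (1 - x))
      - 1 / (?q * (1 - ?q)) * (- (V_rhs (V_hat x) / (x * (1 - x))) / (lL - lR))) (at x)"
    unfolding G_def by (intro derivative_intros log_odds_has_derivative x')
  moreover have "1 / (x * (1 - x))
      - 1 / (?q * (1 - ?q)) * (- (V_rhs (V_hat x) / (x * (1 - x))) / (lL - lR))
    = (?q * (1 - ?q) * (lL - lR) + V_rhs (V_hat x)) / (?q * (1 - ?q) * (lL - lR) * (x * (1 - x)))"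
    using q x' payoff_l by (simp add: divide_simps)
  \<comment> \<open>Substituting \<open>V_hat x = lL - ?q * (lL - lR)\<close> cancels the terms
    quadratic in \<open>?q\<close>.\<close>
  moreover have "?q * (1 - ?q) * (lL - lR) + V_rhs (V_hat x) = (?q - p_lB) * (rR - lR)"
  proof -
    have v: "V_hat x = lL - ?q * (lL - lR)"
      using U_l_q_hat[of x] by (simp add: U_def algebra_simps)
    have "V_rhs (V_hat x) = (rR - V_hat x) * ?q - c / lam"
      by (simp add: V_rhs_def q_hat_def)
    then show ?thesis
      unfolding p_lB_times[symmetric] v by (simp add: algebra_simps)
  qed
  moreover have "0 < (?q - p_lB) * (rR - lR) / (?q * (1 - ?q) * (lL - lR) * (x * (1 - x)))"
    using q x' payoff_l payoff_R by (intro divide_pos_pos mult_pos_pos) auto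
  ultimately show "\<exists>y. (G has_real_derivative y) (at x) \<and> 0 < y" by metis
next
  show "continuous_on {p..q} G"
    by (rule continuous_on_subset[OF continuous_on_G]) (use assms in auto)
qed

lemma V_hat_less_U_l_lowest_belief_iff:
  assumes "0 \<le> \<Delta>" "p_star \<le> p" "p < 1"
  shows "V_hat p < U Act_l (lowest_belief \<Delta> p) \<longleftrightarrow> G p < \<Delta>"
    and V_hat_eq_U_l_lowest_belief_iff: "V_hat p = U Act_l (lowest_belief \<Delta> p) \<longleftrightarrow> G p = \<Delta>"
proof -
  have p: "0 < p" using assms p_star_bounds by simp
  note lb = lowest_belief_bounds[OF assms(1) p assms(3)]
  note q = q_hat_bounds[OF assms(2,3)]
  have 1: "V_hat p < U Act_l (lowest_belief \<Delta> p) \<longleftrightarrow> G p < \<Delta>"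
    unfolding U_l_q_hat[symmetric] U_l_less_iff G_def
    using log_odds_less_iff[OF lb(1,2) q] lb(3) by auto
  have 2: "V_hat p > U Act_l (lowest_belief \<Delta> p) \<longleftrightarrow> G p > \<Delta>"
    unfolding U_l_q_hat[symmetric] U_l_less_iff G_def
    using log_odds_less_iff[OF q lb(1,2)] lb(3) by auto
  show "V_hat p < U Act_l (lowest_belief \<Delta> p) \<longleftrightarrow> G p < \<Delta>" by (rule 1)
  show "V_hat p = U Act_l (lowest_belief \<Delta> p) \<longleftrightarrow> G p = \<Delta>"
    using 1 2 by linarith
qed

text \<open>This trades the definite description in \<open>pbar3\<close> for an inequality: the
  intermediate value theorem provides a solution, and strict monotonicity of \<open>G\<close> makes
  it unique.\<close>

lemma less_pbar3_iff:
  assumes \<Delta>: "0 \<le> \<Delta>" and p: "p_star < p" "p < 1"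
  shows "p < pbar3 \<Delta> \<longleftrightarrow> G p < \<Delta>"
proof (cases "\<Phi> p_star \<ge> U Act_l (lowest_belief \<Delta> p_star)")
  case True
  then have "\<not> G p_star < \<Delta>"
    using V_hat_less_U_l_lowest_belief_iff[OF \<Delta>, of p_star] p_star_bounds
    by (simp add: V_hat_p_star)
  then show ?thesis
    using G_strict_mono[of p_star p] p True by (simp add: pbar3_def)
next
  case False
  then have less: "G p_star < \<Delta>"
    using V_hat_less_U_l_lowest_belief_iff[OF \<Delta>, of p_star] p_star_bounds
    by (simp add: V_hat_p_star)
  \<comment> \<open>Chosen so that \<open>log_odds b - log_odds q_max\<close> is at least
    \<open>\<Delta>\<close>, which forces \<open>\<Delta> \<le> G b\<close>; the maximum keeps
    \<open>b\<close> at or above \<open>p_star\<close>.\<close>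
  obtain b where b: "0 < b" "b < 1" "log_odds b = max (log_odds p_star) (\<Delta> + log_odds q_max)"
    by (rule log_odds_surj)
  have "p_star \<le> b"
    using b p_star_bounds by (subst log_odds_le_iff[symmetric]) auto
  have "log_odds (q_hat b) \<le> log_odds q_max"
    using \<open>p_star \<le> b\<close> b q_hat_le_q_max[of b] q_hat_bounds[of b] q_max_less_1
    by (subst log_odds_le_iff) auto
  then have "\<Delta> \<le> G b" using b by (simp add: G_def)
  moreover have "continuous_on {p_star..b} G"
    by (rule continuous_on_subset[OF continuous_on_G]) (use b in auto)
  ultimately obtain z where z: "p_star \<le> z" "z \<le> b" "G z = \<Delta>"
    using IVT'[of G p_star \<Delta> b] less \<open>p_star \<le> b\<close> by auto
  have "pbar3 \<Delta> = z"
  proof -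
    have "(THE p. p_star \<le> p \<and> p < 1 \<and> V_hat p = U Act_l (lowest_belief \<Delta> p)) = z"
    proof (rule the_equality)
      show "p_star \<le> z \<and> z < 1 \<and> V_hat z = U Act_l (lowest_belief \<Delta> z)"
        using z b V_hat_eq_U_l_lowest_belief_iff[OF \<Delta>, of z] by auto
    next
      fix y assume y: "p_star \<le> y \<and> y < 1 \<and> V_hat y = U Act_l (lowest_belief \<Delta> y)"
      then have "G y = G z"
        using z V_hat_eq_U_l_lowest_belief_iff[OF \<Delta>, of y] by auto
      then show "y = z"
        using y z b G_strict_mono[of y z] G_strict_mono[of z y] by (cases y z rule: linorder_cases) auto
    qed
    then show ?thesis using False by (simp add: pbar3_def)
  qed
  then show ?thesis
    using z b p G_strict_mono[of p z] G_strict_mono[of z p]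
    by (cases p z rule: linorder_cases) auto
qed

end

section \<open>Comparison of stopping times\<close>

context wald_equilibrium
begin

abbreviation stop_prob :: "real \<Rightarrow> real \<Rightarrow> real" where
  "stop_prob \<Delta> p \<equiv> fst (\<sigma> \<Delta> p)"

abbreviation hazard :: "real \<Rightarrow> real \<Rightarrow> real" where
  "hazard \<Delta> p \<equiv> fst (snd (\<sigma> \<Delta> p))"

lemma stop_prob_cases: "stop_prob \<Delta> p = 0 \<or> stop_prob \<Delta> p = 1"
  by (simp add: \<sigma>_def)

lemma stop_prob_bounds: "0 \<le> stop_prob \<Delta> p" "stop_prob \<Delta> p \<le> 1"
  by (simp_all add: \<sigma>_def)

text \<open>Above \<open>pbar1\<close>, not stopping at once is decided by upper thresholds only. So
  a path that does not stop at time 0 meets no atom before reaching \<open>pbar1\<close>.\<close>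

lemma stop_prob_eq_0_downward:
  "stop_prob \<Delta> p = 0 \<Longrightarrow> pbar1 < q \<Longrightarrow> q \<le> p \<Longrightarrow> stop_prob \<Delta> q = 0"
  by (auto simp: \<sigma>_def split: if_splits)

lemma hazard_eq:
  "hazard \<Delta> p = (if p \<in> {max pbar1 p_star<..<pbar3 \<Delta>} then \<nu>_star p else 0)"
  by (auto simp: \<sigma>_def pbar2_def)

lemma \<nu>_star_mono:
  assumes "p_star \<le> p" "p \<le> q" "q < 1"
  shows "\<nu>_star p \<le> \<nu>_star q"
  unfolding \<nu>_star_def using V_hat_antimono[OF assms] payoff_l rate_pos
  by (intro divide_right_mono mult_left_mono) auto

lemma \<nu>_star_nonneg:
  assumes "p_star \<le> p" "p < 1"
  shows "0 \<le> \<nu>_star p"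
proof -
  have "V_hat p \<le> rR"
    using V_hat_antimono[of p_star p] assms \<Phi>_p_star_le by (simp add: V_hat_p_star)
  then show ?thesis
    unfolding \<nu>_star_def using payoff_l rate_pos by simp
qed

lemma hazard_nonneg: "p < 1 \<Longrightarrow> 0 \<le> hazard \<Delta> p"
  unfolding hazard_eq by (auto intro: \<nu>_star_nonneg)

(* log_odds p - \<Delta> is the log odds of the lowest belief. *)
lemma hazard_mono:
  assumes \<Delta>: "0 \<le> \<Delta>" "0 \<le> \<Delta>'"
    and p: "p \<le> p'" "p' < 1"
    and low: "log_odds p' - \<Delta>' \<le> log_odds p - \<Delta>"
  shows "hazard \<Delta> p \<le> hazard \<Delta>' p'"
proof (cases "p \<in> {max pbar1 p_star<..<pbar3 \<Delta>}")
  case True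
  then have ps: "p_star < p" by simp
  then have "G p < \<Delta>"
    using True less_pbar3_iff[OF \<Delta>(1) ps] p by simp
  moreover have "log_odds (q_hat p) \<le> log_odds (q_hat p')"
    using q_hat_mono[of p p'] q_hat_bounds[of p] q_hat_bounds[of p'] ps p
    by (subst log_odds_le_iff) auto
  \<comment> \<open>The lower lowest belief faces a higher indifference belief, so randomization
    persists.\<close>
  ultimately have "G p' < \<Delta>'"
    using low unfolding G_def by linarith
  then have "p' < pbar3 \<Delta>'"
    using less_pbar3_iff[OF \<Delta>(2), of p'] ps p by simp
  then show ?thesis
    using True p ps \<nu>_star_mono[of p p'] unfolding hazard_eq by auto
next
  case False
  then have "hazard \<Delta> p = 0" unfolding hazard_eq by auto
  then show ?thesis using hazard_nonneg[OF p(2)] by simp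
qed

text \<open>Comparing the two hazard integrals requires integrability. The hazard along the path is
  a continuous function cut off outside an open set of times.\<close>

lemma hazard_integrable:
  assumes p: "0 < p" "p < 1"
  shows "(\<lambda>s. hazard \<Delta> (belief_path lam p s)) integrable_on {0..t}"
proof -
  let ?x = "belief_path lam p"
  let ?S = "?x -` {max pbar1 p_star<..<pbar3 \<Delta>}"
  \<comment> \<open>Clamping at \<open>p_star\<close>, below which \<open>V_hat\<close> is not
    controlled, gives a function that is continuous at all times and agrees with the hazard on
    \<open>?S\<close>.\<close>
  let ?g = "\<lambda>s. \<nu>_star (max p_star (?x s))"
  have x: "continuous_on S ?x" for S
    by (rule continuous_on_belief_path[OF p])
  have "open ?S"
    by (rule open_vimage) (auto intro: x)
  have "continuous_on {p_star..<1} \<nu>_star"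
    unfolding \<nu>_star_def using payoff_l by (intro continuous_intros continuous_on_V_hat) auto
  then have "continuous_on {0..t} ?g"
    by (rule continuous_on_compose2)
      (use p_star_bounds belief_path_bounds[OF p] in \<open>auto intro!: continuous_intros x\<close>)
  then have "?g absolutely_integrable_on {0..t}"
    by (rule absolutely_integrable_continuous_real)
  then have "?g absolutely_integrable_on ?S \<inter> {0..t}"
    by (rule set_integrable_subset) (use \<open>open ?S\<close> in auto)
  then have "?g integrable_on ?S \<inter> {0..t}"
    by (rule set_lebesgue_integral_eq_integral(1))
  then have "(\<lambda>s. if s \<in> ?S then ?g s else 0) integrable_on {0..t}"
    by (simp only: integrable_restrict_Int)
  also have "(\<lambda>s. if s \<in> ?S then ?g s else 0) = (\<lambda>s. hazard \<Delta> (?x s))"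
    unfolding hazard_eq by (auto simp: fun_eq_iff max_def)
  finally show ?thesis .
qed

section \<open>Evaluating \<open>F\<close> and comparing nested prior sets\<close>

lemma F_le_1: "F plo phi t \<le> 1"
  unfolding F_def Let_def by (rule stop_cdf_le_1) (rule stop_prob_bounds)+

lemma F_eq_1:
  assumes "0 \<le> s" "s \<le> t" "stop_prob (ambiguity plo phi) (belief_path lam phi s) = 1"
  shows "F plo phi t = 1"
  unfolding F_def Let_def
  by (rule stop_cdf_eq_1[where s = s]) (use assms stop_prob_bounds in auto)

lemma F_eq:
  assumes phi: "0 < phi" "phi < 1" and t: "pbar1 < belief_path lam phi t"
    and 0: "stop_prob (ambiguity plo phi) phi = 0"
  shows "F plo phi t = 1 - exp (- integral {0..t} (\<lambda>s. hazard (ambiguity plo phi) (belief_path lam phi s)))"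
  unfolding F_def Let_def
proof (rule stop_cdf_no_atom)
  fix s assume s: "0 \<le> s" "s \<le> t"
  have "belief_path lam phi t \<le> belief_path lam phi s" "belief_path lam phi s \<le> phi"
    using belief_path_antimono[OF phi, of lam s t] belief_path_antimono[OF phi, of lam 0 s] s rate_pos
    by (simp_all add: belief_path_0)
  then show "stop_prob (ambiguity plo phi) (belief_path lam phi s) = 0"
    using stop_prob_eq_0_downward[OF 0] t by simp
qed

lemma single_crossing:
  assumes P: "0 < plo" "plo \<le> phi" "phi \<le> qhi"
    and Q: "0 < qlo" "qlo \<le> plo" "qhi < 1"
  shows "\<exists>that::real. that \<ge> 0 \<and>
           (\<forall>t. 0 \<le> t \<and> t < that \<longrightarrow> F qlo qhi t \<ge> F plo phi t) \<and>
           (\<forall>t. t > that \<longrightarrow> F qlo qhi t \<le> F plo phi t)"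
proof (cases "stop_prob (ambiguity plo phi) phi = 1")
  case True
  have "F plo phi t = 1" if "t > 0" for t
    by (rule F_eq_1[of 0]) (use True that in \<open>auto simp: belief_path_0\<close>)
  then show ?thesis
    using F_le_1 by (intro exI[of _ 0]) auto
next
  case False
  then have P0: "stop_prob (ambiguity plo phi) phi = 0"
    using stop_prob_cases by blast
  have phi: "0 < phi" "phi < 1" and qhi: "0 < qhi" "qhi < 1"
    using P Q by auto
  have pbar1: "0 < pbar1" "pbar1 < 1"
    using p_lB_pos p_lB_less_1[OF c_less] by (auto simp: pbar1_def)
  \<comment> \<open>Log odds fall at speed \<open>lam\<close>, so this is when the highest belief of
    the smaller set reaches \<open>pbar1\<close>.\<close>
  define T where "T = (log_odds phi - log_odds pbar1) / lam"
  have before: "pbar1 < belief_path lam phi t \<longleftrightarrow> t < T" for t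
    using log_odds_less_iff[OF pbar1 belief_path_bounds[OF phi], of lam t] rate_pos
    by (auto simp: log_odds_belief_path[OF phi] T_def pos_less_divide_eq mult.commute)
  have "\<not> phi \<le> pbar1"
    using P0 by (auto simp: \<sigma>_def)
  then have "0 < T"
    using before[of 0] by (simp add: belief_path_0)
  show ?thesis
  proof (intro exI[of _ T] conjI allI impI)
    show "0 \<le> T" using \<open>0 < T\<close> by simp
  next
    fix t assume "t > T"
    have "stop_prob (ambiguity plo phi) (belief_path lam phi T) = 1"
      using before[of T] by (simp add: \<sigma>_def)
    then have "F plo phi t = 1"
      by (rule F_eq_1[rotated 2]) (use \<open>0 < T\<close> \<open>t > T\<close> in auto)
    then show "F qlo qhi t \<le> F plo phi t"
      using F_le_1 by simp
  next
    fix t assume t: "0 \<le> t \<and> t < T"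
    show "F plo phi t \<le> F qlo qhi t"
    proof (cases "stop_prob (ambiguity qlo qhi) qhi = 1")
      case True
      have "F qlo qhi t = 1"
        by (rule F_eq_1[of 0]) (use True t in \<open>auto simp: belief_path_0\<close>)
      then show ?thesis using F_le_1 by simp
    next
      case False
      then have Q0: "stop_prob (ambiguity qlo qhi) qhi = 0"
        using stop_prob_cases by blast
      let ?h = "\<lambda>s. hazard (ambiguity plo phi) (belief_path lam phi s)"
      let ?k = "\<lambda>s. hazard (ambiguity qlo qhi) (belief_path lam qhi s)"
      have le: "belief_path lam phi s \<le> belief_path lam qhi s" for s
        by (rule belief_path_mono) (use P Q phi in auto)
      have "0 \<le> ambiguity plo phi" "0 \<le> ambiguity qlo qhi"
        using P Q by (auto simp: ambiguity_def log_odds_le_iff)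
      moreover have "log_odds qlo \<le> log_odds plo"
        using P Q by (auto simp: log_odds_le_iff)
      ultimately have "?h s \<le> ?k s" for s
        by (intro hazard_mono le belief_path_bounds qhi)
          (auto simp: log_odds_belief_path phi qhi ambiguity_def)
      then have "integral {0..t} ?h \<le> integral {0..t} ?k"
        by (intro integral_le hazard_integrable phi qhi)
      moreover have "F plo phi t = 1 - exp (- integral {0..t} ?h)"
        using before t by (intro F_eq phi P0) auto
      \<comment> \<open>The higher belief of the larger set has not reached \<open>pbar1\<close>
        either, so it has met no atom.\<close>
      moreover have "F qlo qhi t = 1 - exp (- integral {0..t} ?k)"
        using before[of t] t le[of t] by (intro F_eq qhi Q0) auto
      ultimately show ?thesis by simp
    qed
  qed
qed

end

theorem proposition4:
  fixes u :: "action \<Rightarrow> world \<Rightarrow> real"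
    and c lam d plo phi qlo qhi :: real
  assumes "wald_problem u c lam"
    and "c \<le> wald_problem.c_lower u lam"
    and "(wald_problem.\<Phi> u c lam has_real_derivative d) (at (wald_problem.p_star u c lam))"
    and "d \<ge> 0"
    and "0 < plo" "plo \<le> phi" "phi < 1"
    and "0 < qlo" "qlo \<le> qhi" "qhi < 1"
    and "{plo..phi} \<subseteq> {qlo..qhi}"
  shows "\<exists>that::real. that \<ge> 0 \<and>
           (\<forall>t. 0 \<le> t \<and> t < that \<longrightarrow>
              wald_problem.F u c lam qlo qhi t \<ge> wald_problem.F u c lam plo phi t) \<and>
           (\<forall>t. t > that \<longrightarrow>
              wald_problem.F u c lam qlo qhi t \<le> wald_problem.F u c lam plo phi t)"
proof -
  interpret wald_problem u c lam by fact
  have c: "c < c_upper"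
    using assms(2) c_lower_less_c_upper by simp
  note b = p_lB_pos p_star_greater_p_lB[OF c] p_star_less_1[OF c]
  \<comment> \<open>Derivatives are unique, so \<open>d\<close> is given by the Bellman equation;
    with \<open>d \<ge> 0\<close> and a positive cost this yields
    \<open>\<Phi> p_star < rR\<close>.\<close>
  have "d = (p_star * (rR - \<Phi> p_star) - c / lam) / (p_star * (1 - p_star))"
    by (rule DERIV_unique[OF assms(3) \<Phi>_has_derivative_p_star[OF c]])
  then have "d * (p_star * (1 - p_star)) = p_star * (rR - \<Phi> p_star) - c / lam"
    using b by simp
  moreover have "0 \<le> d * (p_star * (1 - p_star))"
    using assms(4) b by simp
  moreover have "0 < c / lam"
    using cost_pos rate_pos by simp
  ultimately have "0 < p_star * (rR - \<Phi> p_star)"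
    by linarith
  then have "\<Phi> p_star \<le> rR"
    using b by (simp add: zero_less_mult_iff)
  then interpret wald_equilibrium u c lam
    by unfold_locales (rule c)
  have "qlo \<le> plo" "phi \<le> qhi"
    using assms(6,11) by (auto simp: atLeastatMost_subset_iff)
  then show ?thesis
    using assms by (intro single_crossing) auto
qed

end
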